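(* Consider the two-player lattice convex-quadratic simultaneous game in which the $x$-player solves $\min_{x\in\Lambda_1}\frac12 x^\top Q_1x+(C_1y+d_1)^\top x$ and the $y$-player solves $\min_{y\in\Lambda_2}\frac12 y^\top Q_2y+(C_2x+d_2)^\top y$, where $\Lambda_1\subset\mathbb{R}^{n_x}$ and $\Lambda_2\subset\mathbb{R}^{n_y}$ are full-rank lattices, and $Q_1,Q_2$ are symmetric positive definite. Suppose the game has positively adequate objectives (every singular value of $R_1=Q_1^{-1}C_1$ and of $R_2=Q_2^{-1}C_2$ is strictly less than $1$). Then the Best-Response Algorithm terminates finitely, outputting finite sets $S_x$ and $S_y$. Moreover, any mixed-strategy Nash equilibrium of the finite game restricted to $S_x$ and $S_y$ is a $(\Delta_x,\Delta_y)$-mixed-strategy Nash equilibrium of the original game, where $$\Delta_x=\lambda_1^x\left(\pi(Q_1\mid\Lambda_1)+\frac{2\pi(Q_2\mid\Lambda_2)\,\sigma_1^x+2\pi(Q_1\mid\Lambda_1)}{1-\sigma_1^x\sigma_1^y}\right)^2,$$ $$\Delta_y=\lambda_1^y\left(\pi(Q_2\mid\Lambda_2)+\frac{2\pi(Q_1\mid\Lambda_1)\,\sigma_1^y+2\pi(Q_2\mid\Lambda_2)}{1-\sigma_1^x\sigma_1^y}\right)^2,$$ with $\lambda_1^x,\lambda_1^y$ the largest eigenvalues of $Q_1,Q_2$ and $\sigma_1^x,\sigma_1^y$ the largest singular values of $R_1,R_2$, respectively.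
   Context: Here $C_1\in\mathbb{R}^{n_x\times n_y}$, $C_2\in\mathbb{R}^{n_y\times n_x}$, $d_1\in\mathbb{R}^{n_x}$, $d_2\in\mathbb{R}^{n_y}$. A full-rank lattice in $\mathbb{R}^n$ is the set of all integer combinations of $n$ linearly independent vectors. The singular values of an $m\times n$ real matrix $M$ are the square roots of the $n$ eigenvalues of $M^\top M$. Best-Response Algorithm: given any $(\hat x^0,\hat y^0)\in\Lambda_1\times\Lambda_2$, for $i=1,2,\dots$ let $\hat x^i$ be a minimizer over $x\in\Lambda_1$ of the $x$-player's objective with $y=\hat y^{i-1}$ and $\hat y^i$ a minimizer over $y\in\Lambda_2$ of the $y$-player's objective with $x=\hat x^{i-1}$ (ties broken arbitrarily); if $(\hat x^i,\hat y^i)=(\hat x^k,\hat y^k)$ for some $k<i$, terminate and return $S_x=\{\hat x^k,\dots,\hat x^i\}$, $S_y=\{\hat y^k,\dots,\hat y^i\}$. Proximity bound: $\pi(Q\mid\Lambda)$ is the maximum (supremum) of $\|u-v\|_2$ over all $d\in\mathbb{R}^n$, $u\in\mathbb{R}^n$, $v\in\Lambda$ such that $u$ minimizes $\frac12x^\top Qx+d^\top x$ over $\mathbb{R}^n$ and $v$ minimizes it over $\Lambda$. A mixed strategy is a probability distribution on a finite subset of a player's strategies. A pair $\zeta=(\zeta^x,\zeta^y)$ (players randomizing independently) is a $(\Delta_x,\Delta_y)$-mixed-strategy Nash equilibrium if $\mathbb{E}_{(x,y)\sim\zeta}[\frac12x^\top Q_1x+(C_1y+d_1)^\top x]\le\mathbb{E}_{y\sim\zeta^y}[\frac12\bar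 x^\top Q_1\bar x+(C_1y+d_1)^\top\bar x]+\Delta_x$ for all $\bar x\in\Lambda_1$, and $\mathbb{E}_{(x,y)\sim\zeta}[\frac12y^\top Q_2y+(C_2x+d_2)^\top y]\le\mathbb{E}_{x\sim\zeta^x}[\frac12\bar y^\top Q_2\bar y+(C_2x+d_2)^\top\bar y]+\Delta_y$ for all $\bar y\in\Lambda_2$. A mixed-strategy Nash equilibrium is the case $\Delta_x=\Delta_y=0$; for the finite game restricted to $S_x,S_y$, supports and deviations are limited to $S_x$ and $S_y$. *)

theory Defs
  imports "HOL-Probability.Probability"
begin

definition sym_pos_def :: "real^'n^'n \<Rightarrow> bool" where
  "sym_pos_def Q \<longleftrightarrow> transpose Q = Q \<and> (\<forall>x. x \<noteq> 0 \<longrightarrow> 0 < x \<bullet> (Q *v x))"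

definition eigenvalues :: "real^'n^'n \<Rightarrow> real set" where
  "eigenvalues A = {c. \<exists>v. v \<noteq> 0 \<and> A *v v = c *\<^sub>R v}"

definition singular_values :: "real^'n^'m \<Rightarrow> real set" where
  "singular_values M = sqrt ` eigenvalues (transpose M ** M)"

text \<open>Eigenvalues are taken in the reals and without multiplicity, so both maxima below are over
  finite sets, which are nonempty since the matrices concerned are symmetric.\<close>

definition largest_eigenvalue :: "real^'n^'n \<Rightarrow> real" where
  "largest_eigenvalue A = Max (eigenvalues A)"

definition largest_singular_value :: "real^'n^'m \<Rightarrow> real" where
  "largest_singular_value M = Max (singular_values M)"

definition full_rank_lattice :: "(real^'n) set \<Rightarrow> bool" where
  "full_rank_lattice L \<longleftrightarrow>
     (\<exists>B. independent B \<and> card B = CARD('n) \<and>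
          L = {\<Sum>b\<in>B. real_of_int (z b) *\<^sub>R b | z. True})"

definition quad_obj :: "real^'n^'n \<Rightarrow> real^'n \<Rightarrow> real^'n \<Rightarrow> real" where
  "quad_obj Q d x = 1/2 * (x \<bullet> (Q *v x)) + d \<bullet> x"

text \<open>For symmetric positive definite \<open>Q\<close> and a full-rank lattice \<open>L\<close> the set is nonempty and
  bounded, so the real-valued supremum is the genuine one.\<close>

definition proximity :: "real^'n^'n \<Rightarrow> (real^'n) set \<Rightarrow> real" where
  "proximity Q L =
     Sup {norm (u - v) | u v. \<exists>d. is_arg_min (quad_obj Q d) (\<lambda>x. True) u \<and>
                                  is_arg_min (quad_obj Q d) (\<lambda>x. x \<in> L) v}"

text \<open>In the following \<open>f x y\<close> is the cost of the first player and \<open>g x y\<close> that of the second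
  one; \<open>S\<close> and \<open>T\<close> are their strategy sets.\<close>

definition mixed_strategy :: "'a set \<Rightarrow> 'a pmf \<Rightarrow> bool" where
  "mixed_strategy S p \<longleftrightarrow> finite (set_pmf p) \<and> set_pmf p \<subseteq> S"

definition approx_mixed_nash ::
  "('a \<Rightarrow> 'b \<Rightarrow> real) \<Rightarrow> ('a \<Rightarrow> 'b \<Rightarrow> real) \<Rightarrow> 'a set \<Rightarrow> 'b set \<Rightarrow> real \<Rightarrow> real \<Rightarrow>
   'a pmf \<Rightarrow> 'b pmf \<Rightarrow> bool" where
  "approx_mixed_nash f g S T \<Delta>x \<Delta>y p q \<longleftrightarrow>
     mixed_strategy S p \<and> mixed_strategy T q \<and>
     (\<forall>x'\<in>S. measure_pmf.expectation (pair_pmf p q) (\<lambda>(x, y). f x y)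
              \<le> measure_pmf.expectation q (\<lambda>y. f x' y) + \<Delta>x) \<and>
     (\<forall>y'\<in>T. measure_pmf.expectation (pair_pmf p q) (\<lambda>(x, y). g x y)
              \<le> measure_pmf.expectation p (\<lambda>x. g x y') + \<Delta>y)"

definition mixed_nash ::
  "('a \<Rightarrow> 'b \<Rightarrow> real) \<Rightarrow> ('a \<Rightarrow> 'b \<Rightarrow> real) \<Rightarrow> 'a set \<Rightarrow> 'b set \<Rightarrow> 'a pmf \<Rightarrow> 'b pmf \<Rightarrow> bool" where
  "mixed_nash f g S T p q \<longleftrightarrow> approx_mixed_nash f g S T 0 0 p q"

text \<open>A state of the algorithm is the list of all iterates computed so far, the most recent one
  last. The step relation is nondeterministic, which models arbitrary tie-breaking.\<close>

definition br_terminated :: "('a \<times> 'b) list \<Rightarrow> bool" where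
  "br_terminated h \<longleftrightarrow> (\<exists>k < length h - 1. h ! k = last h)"

definition br_step ::
  "('a \<Rightarrow> 'b \<Rightarrow> real) \<Rightarrow> ('a \<Rightarrow> 'b \<Rightarrow> real) \<Rightarrow> 'a set \<Rightarrow> 'b set \<Rightarrow>
   ('a \<times> 'b) list \<Rightarrow> ('a \<times> 'b) list \<Rightarrow> bool" where
  "br_step f g S T h h' \<longleftrightarrow>
     \<not> br_terminated h \<and>
     (\<exists>x y. is_arg_min (\<lambda>x. f x (snd (last h))) (\<lambda>x. x \<in> S) x \<and>
            is_arg_min (\<lambda>y. g (fst (last h)) y) (\<lambda>y. y \<in> T) y \<and>
            h' = h @ [(x, y)])"

text \<open>Every run is finite, and no run gets stuck for lack of a best response.\<close>

definition br_terminates_finitely ::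
  "('a \<Rightarrow> 'b \<Rightarrow> real) \<Rightarrow> ('a \<Rightarrow> 'b \<Rightarrow> real) \<Rightarrow> 'a set \<Rightarrow> 'b set \<Rightarrow> 'a \<Rightarrow> 'b \<Rightarrow> bool" where
  "br_terminates_finitely f g S T x0 y0 \<longleftrightarrow>
     \<not> (\<exists>H :: nat \<Rightarrow> ('a \<times> 'b) list.
           H 0 = [(x0, y0)] \<and> (\<forall>i. br_step f g S T (H i) (H (Suc i)))) \<and>
     (\<forall>h. (br_step f g S T)\<^sup>*\<^sup>* [(x0, y0)] h \<longrightarrow>
          br_terminated h \<or> (\<exists>h'. br_step f g S T h h'))"

text \<open>The index \<open>k\<close> is unique, because a run stops at the first repetition of an iterate.\<close>

definition br_outputs ::
  "('a \<Rightarrow> 'b \<Rightarrow> real) \<Rightarrow> ('a \<Rightarrow> 'b \<Rightarrow> real) \<Rightarrow> 'a set \<Rightarrow> 'b set \<Rightarrow> 'a \<Rightarrow> 'b \<Rightarrow>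
   'a set \<Rightarrow> 'b set \<Rightarrow> bool" where
  "br_outputs f g S T x0 y0 Sx Sy \<longleftrightarrow>
     (\<exists>h k. (br_step f g S T)\<^sup>*\<^sup>* [(x0, y0)] h \<and>
            k < length h - 1 \<and> h ! k = last h \<and>
            Sx = fst ` set (drop k h) \<and> Sy = snd ` set (drop k h))"

definition cost_x ::
  "real^'nx^'nx \<Rightarrow> real^'ny^'nx \<Rightarrow> real^'nx \<Rightarrow> real^'nx \<Rightarrow> real^'ny \<Rightarrow> real" where
  "cost_x Q1 C1 d1 x y = quad_obj Q1 (C1 *v y + d1) x"

definition cost_y ::
  "real^'ny^'ny \<Rightarrow> real^'nx^'ny \<Rightarrow> real^'ny \<Rightarrow> real^'nx \<Rightarrow> real^'ny \<Rightarrow> real" where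
  "cost_y Q2 C2 d2 x y = quad_obj Q2 (C2 *v x + d2) y"

definition positively_adequate ::
  "real^'nx^'nx \<Rightarrow> real^'ny^'nx \<Rightarrow> real^'ny^'ny \<Rightarrow> real^'nx^'ny \<Rightarrow> bool" where
  "positively_adequate Q1 C1 Q2 C2 \<longleftrightarrow>
     (\<forall>s \<in> singular_values (matrix_inv Q1 ** C1). s < 1) \<and>
     (\<forall>s \<in> singular_values (matrix_inv Q2 ** C2). s < 1)"

end

theory Submission
  imports Defs
begin

text \<open>A lattice best response lies within \<open>\<pi>\<close> of the unconstrained one, which depends on the
  opponent's strategy through the contraction \<open>- R\<close>. Hence the iterates stay in a bounded part
  of the lattice and repeat. On a cycle every strategy responds to a strategy of the cycle, so the
  diameters of \<open>S\<^sub>x\<close> and \<open>S\<^sub>y\<close> satisfy \<open>D\<^sub>x \<le> 2\<pi>\<^sub>1 + \<sigma>\<^sub>x D\<^sub>y\<close> and \<open>D\<^sub>y \<le> 2\<pi>\<^sub>2 + \<sigma>\<^sub>y D\<^sub>x\<close>.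
  A strategy of \<open>S\<^sub>x\<close> is therefore within \<open>\<pi>\<^sub>1 + \<sigma>\<^sub>x D\<^sub>y\<close> of the unconstrained best response to
  any mixed strategy on \<open>S\<^sub>y\<close>, and completing the square bounds its loss.\<close>

section \<open>Symmetric matrices\<close>

lemma inner_symmetric_matrix:
  fixes A :: "real^'n^'n"
  assumes "transpose A = A"
  shows "(A *v x) \<bullet> y = x \<bullet> (A *v y)"
  by (metis assms dot_lmul_matrix transpose_matrix_vector)

text \<open>Eigenvectors of a symmetric matrix for distinct eigenvalues are orthogonal, and pairwise
  orthogonal sets in finite dimension are finite. This gives \<open>Max\<close> in
  \<open>largest_eigenvalue\<close> its meaning.\<close>

lemma finite_eigenvalues:
  fixes A :: "real^'n^'n"
  assumes sym: "transpose A = A"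
  shows "finite (eigenvalues A)"
proof -
  have "\<forall>c\<in>eigenvalues A. \<exists>v. v \<noteq> 0 \<and> A *v v = c *\<^sub>R v"
    by (auto simp: eigenvalues_def)
  then obtain e where e: "\<And>c. c \<in> eigenvalues A \<Longrightarrow> e c \<noteq> 0"
      "\<And>c. c \<in> eigenvalues A \<Longrightarrow> A *v e c = c *\<^sub>R e c"
    by metis
  have orth: "orthogonal (e c) (e c')"
    if "c \<in> eigenvalues A" "c' \<in> eigenvalues A" "c \<noteq> c'" for c c'
  proof -
    have "c * (e c \<bullet> e c') = c' * (e c \<bullet> e c')"
      using inner_symmetric_matrix[OF sym, of "e c" "e c'"] that e(2) by simp
    then show ?thesis using that by (simp add: orthogonal_def)
  qed
  have "inj_on e (eigenvalues A)"
    using e(1) orth by (metis inj_onI orthogonal_self)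
  moreover have "finite (e ` eigenvalues A)"
    using orth by (intro pairwise_orthogonal_imp_finite) (auto simp: pairwise_def)
  ultimately show ?thesis by (rule finite_imageD[rotated])
qed

text \<open>Moving from \<open>v\<close> along \<open>w = B *v v\<close> changes the form by
  \<open>2 * t * (w \<bullet> w)\<close> to first order. A suitable negative \<open>t\<close> would
  make the form negative unless \<open>w = 0\<close>.\<close>

lemma kernel_of_psd_form:
  fixes B :: "real^'n^'n"
  assumes sym: "transpose B = B" and psd: "\<And>x. 0 \<le> x \<bullet> (B *v x)" and v: "v \<bullet> (B *v v) = 0"
  shows "B *v v = 0"
proof -
  define w where "w = B *v v"
  define a where "a = w \<bullet> w"
  define b where "b = w \<bullet> (B *v w)"
  \<comment> \<open>For \<open>b > 0\<close> the minimizer of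
    \<open>2 * t * a + t\<^sup>2 * b\<close> is \<open>- a / b\<close>; the denominator
    \<open>b + 1\<close> also covers \<open>b = 0\<close>.\<close>
  define t where "t = - a / (b + 1)"
  have b: "b \<ge> 0" using psd by (simp add: b_def)
  have vw: "v \<bullet> (B *v w) = a"
    by (simp add: a_def w_def inner_symmetric_matrix[OF sym])
  have wv: "w \<bullet> (B *v v) = a" by (simp add: a_def w_def)
  have "0 \<le> (v + t *\<^sub>R w) \<bullet> (B *v (v + t *\<^sub>R w))" by (rule psd)
  also have "\<dots> = 2 * t * a + t\<^sup>2 * b"
    by (simp add: matrix_vector_right_distrib matrix_vector_mult_scaleR inner_add_left
        inner_add_right v vw wv b_def[symmetric] power2_eq_square algebra_simps)
  also have "\<dots> = - (a\<^sup>2 * (b + 2)) / (b + 1)\<^sup>2"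
  proof -
    have "a = - t * (b + 1)" using b by (simp add: t_def)
    moreover have "- (a\<^sup>2 * (b + 2)) / (b + 1)\<^sup>2 = - (t\<^sup>2 * (b + 2))"
      using b by (simp add: t_def power_divide)
    ultimately show ?thesis by (simp only:) (simp add: power2_eq_square algebra_simps)
  qed
  finally have "a\<^sup>2 * (b + 2) / (b + 1)\<^sup>2 \<le> 0" by simp
  then have "a\<^sup>2 * (b + 2) \<le> 0"
    using b by (simp add: divide_le_0_iff)
  then have "a = 0" using b by (simp add: mult_le_0_iff)
  then show ?thesis by (simp add: a_def w_def)
qed

text \<open>A maximizer of the Rayleigh quotient on the unit sphere is an eigenvector for the maximum
  value \<open>m\<close>, because it lies in the kernel of the positive semidefinite form \<open>m I - A\<close>.\<close>

lemma rayleigh_eigenvalue: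
  fixes A :: "real^'n^'n"
  assumes sym: "transpose A = A"
  obtains m where "m \<in> eigenvalues A" "\<And>x. x \<bullet> (A *v x) \<le> m * (norm x)\<^sup>2"
proof -
  have "continuous_on (sphere 0 1) (\<lambda>x. x \<bullet> (A *v x))"
    by (intro continuous_intros matrix_vector_mult_linear_continuous_on)
  moreover have "sphere (0 :: real^'n) 1 \<noteq> {}" by simp
  ultimately obtain v where v: "v \<in> sphere 0 1"
    and vmax: "\<And>x. x \<in> sphere 0 1 \<Longrightarrow> x \<bullet> (A *v x) \<le> v \<bullet> (A *v v)"
    using continuous_attains_sup[OF compact_sphere] by blast
  define m where "m = v \<bullet> (A *v v)"
  have le: "x \<bullet> (A *v x) \<le> m * (norm x)\<^sup>2" for x
  proof (cases "x = 0")
    case False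
    have "(x /\<^sub>R norm x) \<bullet> (A *v (x /\<^sub>R norm x)) \<le> m"
      unfolding m_def by (rule vmax) (simp add: False)
    then have "(x \<bullet> (A *v x)) / (norm x)\<^sup>2 \<le> m"
      by (simp add: matrix_vector_mult_scaleR power2_eq_square field_simps)
    then show ?thesis using False by (simp add: field_simps)
  qed simp
  define B where "B = mat m - A"
  have Bv: "B *v x = m *\<^sub>R x - A *v x" for x
  proof -
    have "mat m *v x = m *\<^sub>R x"
      by (simp add: vec_eq_iff matrix_vector_mult_def mat_def if_distrib[where f = "\<lambda>c. c * _"]
          cong: if_cong)
    then show ?thesis by (simp add: B_def matrix_vector_mult_diff_rdistrib)
  qed
  have "transpose B = B"
    using sym by (simp add: B_def transpose_def vec_eq_iff mat_def)
  moreover have "0 \<le> x \<bullet> (B *v x)" for x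
    using le[of x] by (simp add: Bv inner_diff_right power2_norm_eq_inner)
  moreover have "v \<bullet> (B *v v) = 0"
    using v by (simp add: Bv inner_diff_right m_def flip: power2_norm_eq_inner)
  ultimately have "B *v v = 0" by (rule kernel_of_psd_form)
  then have "m \<in> eigenvalues A"
    using v by (auto simp: eigenvalues_def Bv intro!: exI[of _ v])
  then show ?thesis using le that by blast
qed

lemma quadratic_form_le_largest_eigenvalue:
  fixes A :: "real^'n^'n"
  assumes "transpose A = A"
  shows "x \<bullet> (A *v x) \<le> largest_eigenvalue A * (norm x)\<^sup>2"
proof -
  obtain m where m: "m \<in> eigenvalues A" "x \<bullet> (A *v x) \<le> m * (norm x)\<^sup>2"
    using rayleigh_eigenvalue[OF assms] by metis
  have "m \<le> largest_eigenvalue A"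
    unfolding largest_eigenvalue_def using finite_eigenvalues[OF assms] m(1) by (rule Max_ge)
  then show ?thesis using m(2) by (meson mult_right_mono order_trans zero_le_power2)
qed

section \<open>Singular values as operator bounds\<close>

lemma transpose_gram: "transpose (transpose M ** M) = transpose M ** (M :: real^'n^'m)"
  by (simp add: matrix_transpose_mul)

lemma inner_gram: "x \<bullet> ((transpose M ** M) *v x) = (norm ((M :: real^'n^'m) *v x))\<^sup>2"
  by (metis dot_lmul_matrix inner_commute matrix_vector_mul_assoc power2_norm_eq_inner
      transpose_matrix_vector)

lemma finite_singular_values: "finite (singular_values M)"
  by (simp add: singular_values_def finite_eigenvalues transpose_gram)

text \<open>The Rayleigh quotient of the Gram matrix supplies an eigenvalue, so the finite set is
  nonempty and its maximum is attained. This carries adequacy over to the largest singular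
  value.\<close>

lemma largest_singular_value_mem: "largest_singular_value M \<in> singular_values M"
proof -
  obtain m where "m \<in> eigenvalues (transpose M ** M)"
    using rayleigh_eigenvalue[OF transpose_gram[of M]] by blast
  then have "singular_values M \<noteq> {}" by (auto simp: singular_values_def)
  then show ?thesis
    unfolding largest_singular_value_def using finite_singular_values by (rule Max_in[rotated])
qed

text \<open>This is the square root of the Rayleigh bound for the Gram matrix.\<close>

lemma norm_le_largest_singular_value:
  fixes M :: "real^'n^'m"
  shows "norm (M *v x) \<le> largest_singular_value M * norm x"
proof -
  obtain m where m: "m \<in> eigenvalues (transpose M ** M)"
    "x \<bullet> ((transpose M ** M) *v x) \<le> m * (norm x)\<^sup>2"
    using rayleigh_eigenvalue[OF transpose_gram[of M]] by metis
  have "norm (M *v x) = sqrt ((norm (M *v x))\<^sup>2)" by simp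
  also have "\<dots> \<le> sqrt (m * (norm x)\<^sup>2)"
    using m(2) by (simp only: inner_gram real_sqrt_le_iff)
  also have "\<dots> = sqrt m * norm x" by (simp add: real_sqrt_mult)
  also have "\<dots> \<le> largest_singular_value M * norm x"
    unfolding largest_singular_value_def using m(1)
    by (intro mult_right_mono Max_ge finite_singular_values) (auto simp: singular_values_def)
  finally show ?thesis .
qed

lemma largest_singular_value_nonneg: "0 \<le> largest_singular_value (M :: real^'n^'m)"
proof -
  \<comment> \<open>Any unit vector serves here; \<open>undefined\<close> merely picks some
    index.\<close>
  have "0 \<le> norm (M *v axis undefined 1)" by simp
  also have "\<dots> \<le> largest_singular_value M"
    using norm_le_largest_singular_value[of M "axis undefined 1"] by (simp add: norm_axis_1)
  finally show ?thesis .
qed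

section \<open>Positive definite quadratic objectives\<close>

lemma sym_pos_def_matrix_inv:
  fixes Q :: "real^'n^'n"
  assumes "sym_pos_def Q"
  shows "Q *v (matrix_inv Q *v d) = d"
proof -
  have "x = 0" if "Q *v x = 0" for x
    using assms that by (metis inner_zero_right less_irrefl sym_pos_def_def)
  then have "invertible Q"
    by (simp add: invertible_left_inverse matrix_left_invertible_ker)
  \<comment> \<open>\<open>matrix_inv\<close> is a choice among two-sided inverses, so the existence
    of one yields its property.\<close>
  then have "Q ** matrix_inv Q = mat 1"
    unfolding invertible_def matrix_inv_def by (metis (mono_tags, lifting) someI_ex)
  then show ?thesis by (simp add: matrix_vector_mul_assoc)
qed

lemma largest_eigenvalue_nonneg:
  fixes Q :: "real^'n^'n"
  assumes Q: "sym_pos_def Q"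
  shows "0 \<le> largest_eigenvalue Q"
proof -
  have "0 < axis undefined 1 \<bullet> (Q *v axis undefined 1)"
    using Q by (simp add: sym_pos_def_def axis_eq_0_iff)
  also have "\<dots> \<le> largest_eigenvalue Q"
    using Q quadratic_form_le_largest_eigenvalue[of Q "axis undefined 1"]
    by (simp add: sym_pos_def_def norm_axis_1)
  finally show ?thesis by simp
qed

text \<open>The Rayleigh bound for \<open>- Q\<close> is a lower bound for \<open>Q\<close>. Its
  constant is an eigenvalue of \<open>- Q\<close>, which is negative because the form of
  \<open>Q\<close> is positive at the eigenvector.\<close>

lemma sym_pos_def_coercive:
  fixes Q :: "real^'n^'n"
  assumes Q: "sym_pos_def Q"
  obtains m where "m > 0" "\<And>x. m * (norm x)\<^sup>2 \<le> x \<bullet> (Q *v x)"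
proof -
  have sym: "transpose (- Q) = - Q"
    using Q by (simp add: sym_pos_def_def transpose_def vec_eq_iff)
  obtain m where m: "m \<in> eigenvalues (- Q)" "\<And>x. x \<bullet> ((- Q) *v x) \<le> m * (norm x)\<^sup>2"
    using rayleigh_eigenvalue[OF sym] by metis
  have neg: "(- Q) *v x = - (Q *v x)" for x
    by (simp add: vec_eq_iff matrix_vector_mult_def sum_negf)
  obtain v where v: "v \<noteq> 0" "- (Q *v v) = m *\<^sub>R v"
    using m(1) by (auto simp: eigenvalues_def neg)
  have Qv: "Q *v v = - (m *\<^sub>R v)" by (simp flip: v(2))
  have "0 < v \<bullet> (Q *v v)" using Q v(1) by (simp add: sym_pos_def_def)
  also have "v \<bullet> (Q *v v) = - m * (v \<bullet> v)"
    by (simp add: Qv)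
  finally have "- m > 0"
    by (rule zero_less_mult_pos2) (simp add: v(1))
  moreover have "- m * (norm x)\<^sup>2 \<le> x \<bullet> (Q *v x)" for x
    using m(2)[of x] by (simp add: neg)
  ultimately show ?thesis using that by blast
qed

text \<open>The gradient \<open>Q *v u + d\<close> vanishes at \<open>u\<close>, so the expansion
  around \<open>u\<close> has no linear term.\<close>

lemma quad_obj_complete_square:
  fixes Q :: "real^'n^'n"
  assumes Q: "sym_pos_def Q" and u: "u = - (matrix_inv Q *v d)"
  shows "quad_obj Q d x = quad_obj Q d u + 1/2 * ((x - u) \<bullet> (Q *v (x - u)))"
proof -
  have Qu: "Q *v u = - d"
    using sym_pos_def_matrix_inv[OF Q, of d] by (simp add: u linear_neg[OF matrix_vector_mul_linear])
  have "u \<bullet> (Q *v x) = - d \<bullet> x"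
    using Q Qu by (metis inner_symmetric_matrix sym_pos_def_def)
  then show ?thesis
    by (simp add: quad_obj_def matrix_vector_mult_diff_distrib inner_diff_left inner_diff_right Qu
        inner_add_right inner_commute field_simps)
qed

lemma quad_obj_ge_min:
  fixes Q :: "real^'n^'n"
  assumes Q: "sym_pos_def Q"
  shows "quad_obj Q d (- (matrix_inv Q *v d)) \<le> quad_obj Q d x"
proof -
  have "0 \<le> y \<bullet> (Q *v y)" for y
    using Q by (cases "y = 0") (auto simp: sym_pos_def_def less_imp_le)
  then show ?thesis using quad_obj_complete_square[OF Q refl, of d x] by simp
qed

section \<open>Lattices and best responses\<close>

lemma full_rank_lattice_basis:
  fixes L :: "(real^'n) set"
  assumes "full_rank_lattice L"
  obtains B where "independent B" "finite B" "span B = UNIV"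
    "L = {\<Sum>b\<in>B. real_of_int (z b) *\<^sub>R b | z. True}"
proof -
  obtain B :: "(real^'n) set" where B: "independent B" "card B = CARD('n)"
      "L = {\<Sum>b\<in>B. real_of_int (z b) *\<^sub>R b | z. True}"
    using assms by (auto simp: full_rank_lattice_def)
  have fin: "finite B" using B(1) by (rule finiteI_independent)
  have "UNIV \<subseteq> span B"
    using B fin by (intro card_ge_dim_independent) auto
  with B fin show ?thesis using that by blast
qed

text \<open>Coordinates with respect to the basis are linear, hence bounded on a ball. Integer
  coordinates then lie in a finite box.\<close>

lemma finite_lattice_ball:
  fixes L :: "(real^'n) set"
  assumes "full_rank_lattice L"
  shows "finite {v \<in> L. norm v \<le> r}"
proof -
  obtain B where B: "independent B" "finite B" "span B = UNIV"
    and L: "L = {\<Sum>b\<in>B. real_of_int (z b) *\<^sub>R b | z. True}"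
    using full_rank_lattice_basis[OF assms] by blast
  have "\<exists>K>0. \<forall>v. norm (representation B v b) \<le> K * norm v" for b
  proof -
    have "linear (\<lambda>v. representation B v b)"
      using B by (intro linearI) (simp_all add: representation_add representation_scale)
    then show ?thesis using linear_bounded_pos by metis
  qed
  then obtain K where K: "\<And>b. K b > 0" "\<And>b v. norm (representation B v b) \<le> K b * norm v"
    by metis
  define Z where "Z b = {- \<lceil>K b * r\<rceil>..\<lceil>K b * r\<rceil>}" for b
  have "{v \<in> L. norm v \<le> r} \<subseteq> (\<lambda>z. \<Sum>b\<in>B. real_of_int (z b) *\<^sub>R b) ` (\<Pi>\<^sub>E b\<in>B. Z b)"
  proof
    fix v assume "v \<in> {v \<in> L. norm v \<le> r}"
    then obtain z where v: "v = (\<Sum>b\<in>B. real_of_int (z b) *\<^sub>R b)" and r: "norm v \<le> r"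
      by (auto simp: L)
    have "z b \<in> Z b" if b: "b \<in> B" for b
    proof -
      have "representation B v b = (\<Sum>c\<in>B. real_of_int (z c) * representation B c b)"
        unfolding v using B by (simp add: representation_sum representation_scale)
      also have "\<dots> = (\<Sum>c\<in>B. if c = b then real_of_int (z c) else 0)"
        using B by (intro sum.cong) (auto simp: representation_basis)
      also have "\<dots> = real_of_int (z b)" using b B by simp
      finally have "\<bar>real_of_int (z b)\<bar> \<le> K b * norm v" using K(2)[of v b] by simp
      also have "\<dots> \<le> K b * r" using K(1)[of b] r by simp
      finally show ?thesis unfolding Z_def atLeastAtMost_iff by linarith
    qed
    \<comment> \<open>The coefficients are arbitrary outside \<open>B\<close>; restricting them puts
      them into a finite function space without changing the sum.\<close>
    then have "restrict z B \<in> (\<Pi>\<^sub>E b\<in>B. Z b)" by auto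
    moreover have "v = (\<Sum>b\<in>B. real_of_int (restrict z B b) *\<^sub>R b)" by (simp add: v)
    ultimately show "v \<in> (\<lambda>z. \<Sum>b\<in>B. real_of_int (z b) *\<^sub>R b) ` (\<Pi>\<^sub>E b\<in>B. Z b)" by blast
  qed
  moreover have "finite (\<Pi>\<^sub>E b\<in>B. Z b)" using B by (intro finite_PiE) (auto simp: Z_def)
  ultimately show ?thesis by (meson finite_imageI finite_subset)
qed

text \<open>Rounding every coordinate down costs at most the norm of each basis vector.\<close>

lemma lattice_covering_radius:
  fixes L :: "(real^'n) set"
  assumes "full_rank_lattice L"
  obtains \<rho> where "\<And>u. \<exists>w\<in>L. norm (w - u) \<le> \<rho>"
proof -
  obtain B where B: "independent B" "finite B" "span B = UNIV"
    and L: "L = {\<Sum>b\<in>B. real_of_int (z b) *\<^sub>R b | z. True}"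
    using full_rank_lattice_basis[OF assms] by blast
  have "\<exists>w\<in>L. norm (w - u) \<le> (\<Sum>b\<in>B. norm b)" for u
  proof -
    define w where "w = (\<Sum>b\<in>B. real_of_int \<lfloor>representation B u b\<rfloor> *\<^sub>R b)"
    have "u = (\<Sum>b\<in>B. representation B u b *\<^sub>R b)"
      using B by (simp add: sum_representation_eq)
    then have "w - u = (\<Sum>b\<in>B. (real_of_int \<lfloor>representation B u b\<rfloor> - representation B u b) *\<^sub>R b)"
      unfolding w_def by (simp add: scaleR_left_diff_distrib sum_subtractf)
    also have "norm \<dots> \<le> (\<Sum>b\<in>B. 1 * norm b)"
    proof (intro sum_norm_le)
      fix b
      have "\<bar>real_of_int \<lfloor>representation B u b\<rfloor> - representation B u b\<bar> \<le> 1" by linarith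
      then show "norm ((real_of_int \<lfloor>representation B u b\<rfloor> - representation B u b) *\<^sub>R b) \<le> 1 * norm b"
        unfolding norm_scaleR by (intro mult_right_mono) auto
    qed
    finally have "norm (w - u) \<le> (\<Sum>b\<in>B. norm b)" by simp
    moreover have "w \<in> L"
      unfolding L w_def by (intro CollectI exI[of _ "\<lambda>b. \<lfloor>representation B u b\<rfloor>"]) simp
    ultimately show ?thesis by blast
  qed
  then show ?thesis using that by blast
qed

text \<open>By coercivity the lattice points no worse than a fixed lattice point form a bounded,
  hence finite, set.\<close>

lemma ex_lattice_minimizer:
  fixes Q :: "real^'n^'n" and L :: "(real^'n) set"
  assumes Q: "sym_pos_def Q" and L: "full_rank_lattice L"
  shows "\<exists>v. is_arg_min (quad_obj Q d) (\<lambda>x. x \<in> L) v"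
proof -
  define u where "u = - (matrix_inv Q *v d)"
  obtain m where m: "m > 0" "\<And>x. m * (norm x)\<^sup>2 \<le> x \<bullet> (Q *v x)"
    using sym_pos_def_coercive[OF Q] by blast
  obtain w where w: "w \<in> L" using lattice_covering_radius[OF L] by blast
  define S where "S = {v \<in> L. quad_obj Q d v \<le> quad_obj Q d w}"
  \<comment> \<open>\<open>c\<close> bounds the squared distance to \<open>u\<close> on the sublevel
    set: the excess over the minimum is at least \<open>m / 2\<close> times that square.\<close>
  define c where "c = 2 * (quad_obj Q d w - quad_obj Q d u) / m"
  have "S \<subseteq> {v \<in> L. norm v \<le> sqrt c + norm u}"
  proof
    fix v assume v: "v \<in> S"
    then have "m * (norm (v - u))\<^sup>2 \<le> 2 * (quad_obj Q d w - quad_obj Q d u)"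
      using quad_obj_complete_square[OF Q u_def, of v] m(2)[of "v - u"] by (simp add: S_def)
    then have "(norm (v - u))\<^sup>2 \<le> c"
      using m(1) by (simp add: c_def field_simps)
    then have "norm (v - u) \<le> sqrt c" by (rule real_le_rsqrt)
    then have "norm v \<le> sqrt c + norm u" using norm_triangle_sub[of v u] by simp
    then show "v \<in> {v \<in> L. norm v \<le> sqrt c + norm u}" using v by (simp add: S_def)
  qed
  then have "finite S" using finite_lattice_ball[OF L] finite_subset by blast
  moreover have "S \<noteq> {}" using w by (auto simp: S_def)
  ultimately obtain v where "is_arg_min (quad_obj Q d) (\<lambda>x. x \<in> S) v"
    using ex_is_arg_min_if_finite by blast
  \<comment> \<open>Lattice points outside \<open>S\<close> cost more than \<open>w\<close>, which
    lies in \<open>S\<close>.\<close>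
  then have "is_arg_min (quad_obj Q d) (\<lambda>x. x \<in> L) v"
    by (force simp: is_arg_min_linorder S_def)
  then show ?thesis ..
qed

text \<open>A lattice point within \<open>\<rho>\<close> of the unconstrained minimizer exceeds the
  minimum by at most \<open>l * \<rho>\<^sup>2 / 2\<close>. A lattice minimizer does no worse, and
  coercivity turns this excess into a distance that does not depend on \<open>d\<close>.\<close>

lemma bdd_above_proximity:
  fixes Q :: "real^'n^'n" and L :: "(real^'n) set"
  assumes Q: "sym_pos_def Q" and L: "full_rank_lattice L"
  shows "bdd_above {norm (u - v) | u v. \<exists>d. is_arg_min (quad_obj Q d) (\<lambda>x. True) u \<and>
           is_arg_min (quad_obj Q d) (\<lambda>x. x \<in> L) v}"
proof -
  obtain m where m: "m > 0" "\<And>x. m * (norm x)\<^sup>2 \<le> x \<bullet> (Q *v x)"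
    using sym_pos_def_coercive[OF Q] by blast
  obtain \<rho> where \<rho>: "\<And>u. \<exists>w\<in>L. norm (w - u) \<le> \<rho>"
    using lattice_covering_radius[OF L] by blast
  define l where "l = largest_eigenvalue Q"
  have l0: "0 \<le> l" unfolding l_def by (rule largest_eigenvalue_nonneg[OF Q])
  have l: "x \<bullet> (Q *v x) \<le> l * (norm x)\<^sup>2" for x
    using Q unfolding l_def by (simp add: sym_pos_def_def quadratic_form_le_largest_eigenvalue)
  have "norm (a - v) \<le> sqrt (l * \<rho>\<^sup>2 / m)"
    if a: "is_arg_min (quad_obj Q d) (\<lambda>x. True) a"
      and v: "is_arg_min (quad_obj Q d) (\<lambda>x. x \<in> L) v" for a v d
  proof -
    define u where "u = - (matrix_inv Q *v d)"
    note sq = quad_obj_complete_square[OF Q u_def]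
    have "quad_obj Q d a \<le> quad_obj Q d u" using a by (simp add: is_arg_min_linorder)
    then have "m * (norm (a - u))\<^sup>2 \<le> 0" using sq[of a] m(2)[of "a - u"] by linarith
    \<comment> \<open>Positive definiteness makes the unconstrained minimizer unique.\<close>
    then have au: "a = u" using m(1) by (simp add: mult_le_0_iff)
    obtain w where w: "w \<in> L" "norm (w - u) \<le> \<rho>" using \<rho> by blast
    have "m * (norm (v - u))\<^sup>2 \<le> (v - u) \<bullet> (Q *v (v - u))" by (rule m)
    also have "\<dots> \<le> (w - u) \<bullet> (Q *v (w - u))"
      using v w(1) sq[of v] sq[of w] by (auto simp: is_arg_min_linorder)
    also have "\<dots> \<le> l * (norm (w - u))\<^sup>2" by (rule l)
    also have "\<dots> \<le> l * \<rho>\<^sup>2" using w(2) l0 by (intro mult_left_mono power_mono) auto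
    finally have "(norm (v - u))\<^sup>2 \<le> l * \<rho>\<^sup>2 / m" using m(1) by (simp add: field_simps)
    then show ?thesis unfolding au by (metis norm_minus_commute real_le_rsqrt)
  qed
  then show ?thesis by (intro bdd_aboveI[where M = "sqrt (l * \<rho>\<^sup>2 / m)"]) auto
qed

text \<open>The vector in the norm is \<open>v\<close> minus the unconstrained minimizer, so its
  norm is among those whose supremum is taken.\<close>

lemma lattice_minimizer_proximity:
  fixes Q :: "real^'n^'n" and L :: "(real^'n) set"
  assumes Q: "sym_pos_def Q" and L: "full_rank_lattice L"
    and v: "is_arg_min (quad_obj Q d) (\<lambda>x. x \<in> L) v"
  shows "norm (v + matrix_inv Q *v d) \<le> proximity Q L"
proof -
  have "is_arg_min (quad_obj Q d) (\<lambda>x. True) (- (matrix_inv Q *v d))"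
    using quad_obj_ge_min[OF Q] by (simp add: is_arg_min_linorder)
  then have "norm (- (matrix_inv Q *v d) - v) \<le> proximity Q L"
    unfolding proximity_def using v by (intro cSup_upper bdd_above_proximity Q L) blast
  moreover have "norm (- (matrix_inv Q *v d) - v) = norm (v + matrix_inv Q *v d)"
    by (metis add.commute minus_add_distrib norm_minus_cancel uminus_add_conv_diff)
  ultimately show ?thesis by simp
qed

lemma proximity_nonneg:
  fixes Q :: "real^'n^'n" and L :: "(real^'n) set"
  assumes Q: "sym_pos_def Q" and L: "full_rank_lattice L"
  shows "0 \<le> proximity Q L"
  using ex_lattice_minimizer[OF Q L, of 0] lattice_minimizer_proximity[OF Q L]
  by (meson norm_ge_zero order_trans)

section \<open>Best responses as the opponent's strategy varies\<close>

lemma response_diff: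
  "matrix_inv Q *v (C *v y + d) - matrix_inv Q *v (C *v y' + d) =
    (matrix_inv Q ** C) *v (y - y')" for Q :: "real^'n^'n" and C :: "real^'m^'n"
  by (simp add: matrix_vector_right_distrib matrix_vector_mult_diff_distrib
      matrix_vector_mul_assoc)

text \<open>One player is treated in isolation, with \<open>y\<close> for the opponent's strategy,
  so that every result can be instantiated for both players.\<close>

context
  fixes Q :: "real^'n^'n" and C :: "real^'m^'n" and d :: "real^'n" and L :: "(real^'n) set"
    and \<pi> \<sigma> :: real
  assumes Q: "sym_pos_def Q" and L: "full_rank_lattice L"
  defines "\<pi> \<equiv> proximity Q L" and "\<sigma> \<equiv> largest_singular_value (matrix_inv Q ** C)"
begin

text \<open>\<open>v\<close> is within \<open>\<pi>\<close> of the unconstrained response to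
  \<open>y\<close>, and replacing \<open>y\<close> by \<open>y'\<close> moves that response by at
  most \<open>\<sigma> * norm (y - y')\<close>.\<close>

lemma best_response_near:
  assumes "is_arg_min (quad_obj Q (C *v y + d)) (\<lambda>x. x \<in> L) v"
  shows "norm (v + matrix_inv Q *v (C *v y' + d)) \<le> \<pi> + \<sigma> * norm (y - y')"
proof -
  have "v + matrix_inv Q *v (C *v y' + d) =
      (v + matrix_inv Q *v (C *v y + d)) - (matrix_inv Q ** C) *v (y - y')"
    by (simp flip: response_diff[of Q C y d y'])
  also have "norm \<dots> \<le> norm (v + matrix_inv Q *v (C *v y + d)) +
      norm ((matrix_inv Q ** C) *v (y - y'))"
    by (rule norm_triangle_ineq4)
  also have "\<dots> \<le> \<pi> + \<sigma> * norm (y - y')"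
    unfolding \<pi>_def \<sigma>_def
    by (intro add_mono lattice_minimizer_proximity[OF Q L] norm_le_largest_singular_value assms)
  finally show ?thesis .
qed

text \<open>The comparison is with the unconstrained response \<open>- (matrix_inv Q *v d)\<close>
  to the zero strategy.\<close>

lemma best_response_norm:
  assumes "is_arg_min (quad_obj Q (C *v y + d)) (\<lambda>x. x \<in> L) v"
  shows "norm v \<le> \<pi> + norm (matrix_inv Q *v d) + \<sigma> * norm y"
  using best_response_near[OF assms, of 0] norm_triangle_ineq4[of "v + matrix_inv Q *v d" "matrix_inv Q *v d"]
  by simp

lemma best_response_dist:
  assumes v: "is_arg_min (quad_obj Q (C *v y + d)) (\<lambda>x. x \<in> L) v"
    and v': "is_arg_min (quad_obj Q (C *v y' + d)) (\<lambda>x. x \<in> L) v'"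
  shows "norm (v - v') \<le> 2 * \<pi> + \<sigma> * norm (y - y')"
proof -
  \<comment> \<open>Both responses are measured from the unconstrained response \<open>- ?r\<close>
    to \<open>y'\<close>, so \<open>\<sigma>\<close> enters only once.\<close>
  let ?r = "matrix_inv Q *v (C *v y' + d)"
  have "norm (v - v') \<le> norm (v + ?r) + norm (v' + ?r)"
    using norm_triangle_ineq4[of "v + ?r" "v' + ?r"] by simp
  also have "\<dots> \<le> (\<pi> + \<sigma> * norm (y - y')) + (\<pi> + \<sigma> * norm (y' - y'))"
    by (intro add_mono best_response_near v v')
  finally show ?thesis by simp
qed

text \<open>The objective is affine in the opponent's strategy, so against a mixed strategy \<open>q\<close> the player
  faces the objective for the mean of \<open>q\<close>. The best response \<open>s\<close> to a pure strategy near that mean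
  is close to the unconstrained minimizer of this objective.\<close>

lemma best_response_mixed:
  fixes q :: "(real^'m) pmf"
  assumes q: "finite (set_pmf q)"
    and s: "is_arg_min (quad_obj Q (C *v y + d)) (\<lambda>x. x \<in> L) s"
    and D: "\<And>y'. y' \<in> set_pmf q \<Longrightarrow> norm (y - y') \<le> D"
  shows "measure_pmf.expectation q (\<lambda>y. quad_obj Q (C *v y + d) s) \<le>
    measure_pmf.expectation q (\<lambda>y. quad_obj Q (C *v y + d) x) +
      largest_eigenvalue Q * (\<pi> + \<sigma> * D)\<^sup>2"
proof -
  define m where "m = measure_pmf.expectation q (\<lambda>y. y)"
  define u where "u = - (matrix_inv Q *v (C *v m + d))"
  define l where "l = largest_eigenvalue Q"
  have int: "integrable (measure_pmf q) h" for h :: "real^'m \<Rightarrow> 'b::{banach,second_countable_topology}"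
    using q by (rule integrable_measure_pmf_finite)
  have mean: "measure_pmf.expectation q (\<lambda>y. quad_obj Q (C *v y + d) z) = quad_obj Q (C *v m + d) z" for z
  proof -
    have "bounded_linear (\<lambda>y. (C *v y) \<bullet> z)"
      by (intro bounded_linear_compose[OF bounded_linear_inner_left] matrix_vector_mul_bounded_linear)
    then have "measure_pmf.expectation q (\<lambda>y. (C *v y) \<bullet> z) = (C *v m) \<bullet> z"
      unfolding m_def by (intro integral_bounded_linear int)
    then show ?thesis by (simp add: quad_obj_def inner_add_left Bochner_Integration.integral_add int)
  qed
  \<comment> \<open>The mean is a convex combination of the support, which lies in the ball of
    radius \<open>D\<close> around \<open>y\<close>.\<close>
  have "m = (\<Sum>a\<in>set_pmf q. pmf q a *\<^sub>R a)"
    unfolding m_def using q by (subst integral_measure_pmf[of "set_pmf q"]) auto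
  also have "\<dots> \<in> cball y D"
    using q D by (intro convex_sum) (auto simp: dist_norm sum_pmf_eq_1)
  finally have m: "norm (y - m) \<le> D" by (simp add: dist_norm)
  have l: "x \<bullet> (Q *v x) \<le> l * (norm x)\<^sup>2" for x
    using Q unfolding l_def by (simp add: sym_pos_def_def quadratic_form_le_largest_eigenvalue)
  have l0: "0 \<le> l" unfolding l_def by (rule largest_eigenvalue_nonneg[OF Q])
  have "norm (s - u) \<le> \<pi> + \<sigma> * norm (y - m)"
    using best_response_near[OF s, of m] by (simp add: u_def)
  also have "\<dots> \<le> \<pi> + \<sigma> * D"
    using m by (intro add_left_mono mult_left_mono) (auto simp: \<sigma>_def largest_singular_value_nonneg)
  finally have su: "norm (s - u) \<le> \<pi> + \<sigma> * D" .
  have "(s - u) \<bullet> (Q *v (s - u)) \<le> l * (norm (s - u))\<^sup>2" by (rule l)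
  also have "\<dots> \<le> l * (\<pi> + \<sigma> * D)\<^sup>2" using su l0 by (intro mult_left_mono power_mono) auto
  finally have "quad_obj Q (C *v m + d) s \<le> quad_obj Q (C *v m + d) u + 1/2 * (l * (\<pi> + \<sigma> * D)\<^sup>2)"
    using quad_obj_complete_square[OF Q u_def, of s] by simp
  moreover have "quad_obj Q (C *v m + d) u \<le> quad_obj Q (C *v m + d) x"
    unfolding u_def by (rule quad_obj_ge_min[OF Q])
  \<comment> \<open>Completing the square gives half of the claimed error; the other half is given
    away.\<close>
  moreover have "0 \<le> l * (\<pi> + \<sigma> * D)\<^sup>2" using l0 by simp
  ultimately show ?thesis unfolding mean l_def by linarith
qed

end

section \<open>Runs of the best-response algorithm\<close>

text \<open>This separates the simultaneous update from the history and the stopping test, so that a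
  run becomes a sequence of pairs.\<close>

definition br_pair ::
  "('a \<Rightarrow> 'b \<Rightarrow> real) \<Rightarrow> ('a \<Rightarrow> 'b \<Rightarrow> real) \<Rightarrow> 'a set \<Rightarrow> 'b set \<Rightarrow> 'a \<times> 'b \<Rightarrow> 'a \<times> 'b \<Rightarrow> bool" where
  "br_pair f g S T z z' \<longleftrightarrow>
     is_arg_min (\<lambda>x. f x (snd z)) (\<lambda>x. x \<in> S) (fst z') \<and>
     is_arg_min (\<lambda>y. g (fst z) y) (\<lambda>y. y \<in> T) (snd z')"

lemma br_step_iff:
  "br_step f g S T h h' \<longleftrightarrow> \<not> br_terminated h \<and> (\<exists>z. br_pair f g S T (last h) z \<and> h' = h @ [z])"
  by (auto simp: br_step_def br_pair_def)

lemma br_pair_mem: "br_pair f g S T z z' \<Longrightarrow> z' \<in> S \<times> T"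
  by (auto simp: br_pair_def is_arg_min_def mem_Times_iff)

lemma br_run_invariant:
  assumes "(br_step f g S T)\<^sup>*\<^sup>* [z0] h" and "z0 \<in> S \<times> T"
  shows "h \<noteq> []" "set h \<subseteq> S \<times> T"
    "\<And>i. Suc i < length h \<Longrightarrow> br_pair f g S T (h ! i) (h ! Suc i)"
proof -
  have "h \<noteq> [] \<and> set h \<subseteq> S \<times> T \<and>
    (\<forall>i. Suc i < length h \<longrightarrow> br_pair f g S T (h ! i) (h ! Suc i))"
    using assms(1)
  proof (induction rule: rtranclp_induct)
    case base
    then show ?case using assms(2) by simp
  next
    case (step h h')
    then obtain z where z: "br_pair f g S T (last h) z" "h' = h @ [z]"
      by (auto simp: br_step_iff)
    have "br_pair f g S T (h' ! i) (h' ! Suc i)" if i: "Suc i < length h'" for i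
    proof (cases "Suc i < length h")
      case True
      then show ?thesis using step.IH z(2) by (simp add: nth_append)
    next
      case False
      \<comment> \<open>The only new transition leads from the old last iterate to the appended
        one.\<close>
      then have "Suc i = length h" using i z(2) by simp
      then have "h' ! i = last h" "h' ! Suc i = z"
        using step.IH by (simp_all add: z(2) nth_append last_conv_nth flip: \<open>Suc i = length h\<close>)
      then show ?thesis using z(1) by simp
    qed
    then show ?case using step.IH z br_pair_mem[OF z(1)] by auto
  qed
  then show "h \<noteq> []" "set h \<subseteq> S \<times> T"
    "\<And>i. Suc i < length h \<Longrightarrow> br_pair f g S T (h ! i) (h ! Suc i)" by auto
qed

text \<open>All that the equilibrium bound uses of the algorithm is a finite set of pairs closed
  under taking some predecessor; the outputs are its projections.\<close>

lemma br_outputs_closed: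
  assumes "br_outputs f g S T x0 y0 Sx Sy" and "x0 \<in> S" "y0 \<in> T"
  obtains P where "finite P" "P \<noteq> {}" "P \<subseteq> S \<times> T" "Sx = fst ` P" "Sy = snd ` P"
    "\<And>z'. z' \<in> P \<Longrightarrow> \<exists>z\<in>P. br_pair f g S T z z'"
proof -
  obtain h k where run: "(br_step f g S T)\<^sup>*\<^sup>* [(x0, y0)] h"
    and k: "k < length h - 1" "h ! k = last h"
    and out: "Sx = fst ` set (drop k h)" "Sy = snd ` set (drop k h)"
    using assms(1) by (auto simp: br_outputs_def)
  have "(x0, y0) \<in> S \<times> T" using assms(2,3) by simp
  note inv = br_run_invariant[OF run this]
  have "\<exists>z\<in>set (drop k h). br_pair f g S T z z'" if z': "z' \<in> set (drop k h)" for z'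
  proof -
    \<comment> \<open>The first element of the cycle equals the last one, which has its predecessor in the cycle.\<close>
    have "\<exists>j>k. j < length h \<and> z' = h ! j"
    proof -
      obtain i where i: "i < length h - k" "z' = h ! (k + i)"
        using z' by (auto simp: in_set_conv_nth)
      show ?thesis
      proof (cases i)
        case 0
        then show ?thesis
          using i k by (intro exI[of _ "length h - 1"]) (auto simp: last_conv_nth inv(1))
      next
        case (Suc n)
        then show ?thesis using i by (intro exI[of _ "k + i"]) auto
      qed
    qed
    then obtain j where j: "k < j" "j < length h" "z' = h ! j" by blast
    have "br_pair f g S T (h ! (j - 1)) z'"
      using inv(3)[of "j - 1"] j by simp
    moreover have "h ! (j - 1) \<in> set (drop k h)"
      using j by (auto simp: in_set_conv_nth intro!: exI[of _ "j - 1 - k"])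
    ultimately show ?thesis by blast
  qed
  moreover have "set (drop k h) \<subseteq> S \<times> T" using inv(2) set_drop_subset by (meson order_trans)
  moreover have "set (drop k h) \<noteq> {}" using k by simp
  ultimately show ?thesis using out that by blast
qed

text \<open>A repeated iterate stops the run, so an infinite run would be an injective sequence and
  have infinite range.\<close>

lemma br_terminates_finitelyI:
  assumes z0: "x0 \<in> S" "y0 \<in> T"
    and ex: "\<And>z. \<exists>z'. br_pair f g S T z z'"
    and fin: "\<And>Z. Z 0 = (x0, y0) \<Longrightarrow> (\<And>i. br_pair f g S T (Z i) (Z (Suc i))) \<Longrightarrow> finite (range Z)"
  shows "br_terminates_finitely f g S T x0 y0"
  unfolding br_terminates_finitely_def
proof (intro conjI notI allI impI)
  assume "\<exists>H. H 0 = [(x0, y0)] \<and> (\<forall>i. br_step f g S T (H i) (H (Suc i)))"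
  then obtain H where H0: "H 0 = [(x0, y0)]" and H: "\<And>i. br_step f g S T (H i) (H (Suc i))"
    by blast
  define Z where "Z i = last (H i)" for i
  have step: "br_pair f g S T (Z i) (Z (Suc i))" "H (Suc i) = H i @ [Z (Suc i)]"
    "\<not> br_terminated (H i)" for i
    using H[of i] by (auto simp: br_step_iff Z_def)
  have H_eq: "H i = map Z [0..<Suc i]" for i
  proof (induction i)
    case 0
    then show ?case by (simp add: H0 Z_def)
  next
    case (Suc i)
    show ?case unfolding step(2) Suc.IH by simp
  qed
  \<comment> \<open>\<open>H i\<close> has length \<open>Suc i\<close>, so the indices
    \<open>k < i\<close> are exactly those that the stopping test compares with the last
    entry.\<close>
  have "Z k \<noteq> Z i" if "k < i" for k i
    using step(3)[of i] that by (auto simp: br_terminated_def H_eq nth_append last_map)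
  then have "inj Z" by (metis injI linorder_neqE_nat)
  moreover have "finite (range Z)" using step(1) H0 by (intro fin) (auto simp: Z_def)
  ultimately show False using finite_imageD infinite_UNIV_nat by blast
next
  fix h
  show "br_terminated h \<or> (\<exists>h'. br_step f g S T h h')"
    using ex by (auto simp: br_step_iff)
qed

text \<open>\<open>c / (1 - r)\<close> is the fixed point of the map sending \<open>t\<close> to
  \<open>c + r * t\<close>, and this map does not increase any value above its fixed point.\<close>

lemma contraction_iterates_bounded:
  fixes a :: "nat \<Rightarrow> real"
  assumes "0 \<le> r" "r < 1" and "\<And>i. a (Suc i) \<le> c + r * a i"
  shows "a i \<le> max (a 0) (c / (1 - r))"
proof (induction i)
  case (Suc i)
  let ?M = "max (a 0) (c / (1 - r))"
  have "c \<le> (1 - r) * ?M"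
  proof -
    have "c = (1 - r) * (c / (1 - r))" using assms by simp
    also have "\<dots> \<le> (1 - r) * ?M" using assms by (intro mult_left_mono) auto
    finally show ?thesis .
  qed
  moreover have "a (Suc i) \<le> c + r * ?M"
    using assms(3)[of i] mult_left_mono[OF Suc.IH assms(1)] by linarith
  ultimately show ?case by (simp add: algebra_simps)
qed simp

theorem corollary10:
  fixes Q1 :: "real^'nx^'nx" and Q2 :: "real^'ny^'ny"
    and C1 :: "real^'ny^'nx" and C2 :: "real^'nx^'ny"
    and d1 :: "real^'nx" and d2 :: "real^'ny"
    and \<Lambda>1 :: "(real^'nx) set" and \<Lambda>2 :: "(real^'ny) set"
  assumes "full_rank_lattice \<Lambda>1" and "full_rank_lattice \<Lambda>2"
    and "sym_pos_def Q1" and "sym_pos_def Q2"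
    and "positively_adequate Q1 C1 Q2 C2"
  shows
    "let f = cost_x Q1 C1 d1;
         g = cost_y Q2 C2 d2;
         lx = largest_eigenvalue Q1;
         ly = largest_eigenvalue Q2;
         \<sigma>x = largest_singular_value (matrix_inv Q1 ** C1);
         \<sigma>y = largest_singular_value (matrix_inv Q2 ** C2);
         \<pi>1 = proximity Q1 \<Lambda>1;
         \<pi>2 = proximity Q2 \<Lambda>2;
         \<Delta>x = lx * (\<pi>1 + (2 * \<pi>2 * \<sigma>x + 2 * \<pi>1) / (1 - \<sigma>x * \<sigma>y))\<^sup>2;
         \<Delta>y = ly * (\<pi>2 + (2 * \<pi>1 * \<sigma>y + 2 * \<pi>2) / (1 - \<sigma>x * \<sigma>y))\<^sup>2
     in \<forall>x0\<in>\<Lambda>1. \<forall>y0\<in>\<Lambda>2.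
          br_terminates_finitely f g \<Lambda>1 \<Lambda>2 x0 y0 \<and>
          (\<forall>Sx Sy. br_outputs f g \<Lambda>1 \<Lambda>2 x0 y0 Sx Sy \<longrightarrow>
             finite Sx \<and> finite Sy \<and>
             (\<forall>p q. mixed_nash f g Sx Sy p q \<longrightarrow>
                    approx_mixed_nash f g \<Lambda>1 \<Lambda>2 \<Delta>x \<Delta>y p q))"
proof -
  note L1 = assms(1) and L2 = assms(2) and Q1 = assms(3) and Q2 = assms(4)
  define f where "f = cost_x Q1 C1 d1"
  define g where "g = cost_y Q2 C2 d2"
  define lx where "lx = largest_eigenvalue Q1"
  define ly where "ly = largest_eigenvalue Q2"
  define \<sigma>x where "\<sigma>x = largest_singular_value (matrix_inv Q1 ** C1)"
  define \<sigma>y where "\<sigma>y = largest_singular_value (matrix_inv Q2 ** C2)"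
  define \<pi>1 where "\<pi>1 = proximity Q1 \<Lambda>1"
  define \<pi>2 where "\<pi>2 = proximity Q2 \<Lambda>2"
  \<comment> \<open>\<open>Bx\<close> and \<open>By\<close> will bound \<open>\<sigma>x * Dy\<close>
    and \<open>\<sigma>y * Dx\<close>, where \<open>Dx\<close> and \<open>Dy\<close> are the
    diameters of the output sets.\<close>
  define Bx where "Bx = (2 * \<pi>2 * \<sigma>x + 2 * \<pi>1) / (1 - \<sigma>x * \<sigma>y)"
  define By where "By = (2 * \<pi>1 * \<sigma>y + 2 * \<pi>2) / (1 - \<sigma>x * \<sigma>y)"
  have \<sigma>: "0 \<le> \<sigma>x" "0 \<le> \<sigma>y" "\<sigma>x < 1" "\<sigma>y < 1"
    using assms(5) largest_singular_value_mem
    by (auto simp: \<sigma>x_def \<sigma>y_def positively_adequate_def largest_singular_value_nonneg)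
  have \<sigma>\<sigma>: "\<sigma>x * \<sigma>y < 1" using \<sigma> by (metis mult_left_le order_le_less_trans less_imp_le)
  have \<pi>: "0 \<le> \<pi>1" "0 \<le> \<pi>2" by (simp_all add: \<pi>1_def \<pi>2_def proximity_nonneg L1 L2 Q1 Q2)
  have br: "br_pair f g \<Lambda>1 \<Lambda>2 z z' \<longleftrightarrow>
      is_arg_min (quad_obj Q1 (C1 *v snd z + d1)) (\<lambda>x. x \<in> \<Lambda>1) (fst z') \<and>
      is_arg_min (quad_obj Q2 (C2 *v fst z + d2)) (\<lambda>y. y \<in> \<Lambda>2) (snd z')" for z z'
    by (simp add: br_pair_def f_def g_def cost_x_def cost_y_def)

  \<comment> \<open>Termination by boundedness of the iterates\<close>
  have terminates: "br_terminates_finitely f g \<Lambda>1 \<Lambda>2 x0 y0" if z0: "x0 \<in> \<Lambda>1" "y0 \<in> \<Lambda>2" for x0 y0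
  proof (rule br_terminates_finitelyI[OF z0])
    fix z show "\<exists>z'. br_pair f g \<Lambda>1 \<Lambda>2 z z'"
      using ex_lattice_minimizer[OF Q1 L1] ex_lattice_minimizer[OF Q2 L2]
      unfolding br by (metis fst_conv snd_conv)
  next
    fix Z assume Z0: "Z 0 = (x0, y0)" and Z: "\<And>i. br_pair f g \<Lambda>1 \<Lambda>2 (Z i) (Z (Suc i))"
    \<comment> \<open>Each player's norm is controlled by the opponent's previous one. Taking the
      larger of the two norms uncouples this into one recursion with rate
      \<open>max \<sigma>x \<sigma>y\<close>.\<close>
    define a where "a i = max (norm (fst (Z i))) (norm (snd (Z i)))" for i
    define r where "r = max \<sigma>x \<sigma>y"
    define c where "c = max (\<pi>1 + norm (matrix_inv Q1 *v d1)) (\<pi>2 + norm (matrix_inv Q2 *v d2))"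
    have step: "a (Suc i) \<le> c + r * a i" for i
    proof -
      have "norm (fst (Z (Suc i))) \<le> \<pi>1 + norm (matrix_inv Q1 *v d1) + \<sigma>x * norm (snd (Z i))"
        unfolding \<pi>1_def \<sigma>x_def using Z[of i] by (intro best_response_norm Q1 L1) (simp add: br)
      also have "\<dots> \<le> c + r * a i"
        unfolding c_def r_def a_def using \<sigma> by (intro add_mono mult_mono) auto
      finally have x: "norm (fst (Z (Suc i))) \<le> c + r * a i" .
      have "norm (snd (Z (Suc i))) \<le> \<pi>2 + norm (matrix_inv Q2 *v d2) + \<sigma>y * norm (fst (Z i))"
        unfolding \<pi>2_def \<sigma>y_def using Z[of i] by (intro best_response_norm Q2 L2) (simp add: br)
      also have "\<dots> \<le> c + r * a i"
        unfolding c_def r_def a_def using \<sigma> by (intro add_mono mult_mono) auto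
      finally show ?thesis using x by (simp add: a_def[of "Suc i"])
    qed
    define M where "M = max (a 0) (c / (1 - r))"
    have M: "a i \<le> M" for i
      unfolding M_def using \<sigma> by (intro contraction_iterates_bounded step) (auto simp: r_def)
    have "Z i \<in> \<Lambda>1 \<times> \<Lambda>2" for i
      using Z0 z0 br_pair_mem[OF Z] by (cases i) auto
    then have "range Z \<subseteq> {x \<in> \<Lambda>1. norm x \<le> M} \<times> {y \<in> \<Lambda>2. norm y \<le> M}"
      using M by (intro image_subsetI) (auto simp: a_def mem_Times_iff)
    then show "finite (range Z)"
      using finite_lattice_ball[OF L1] finite_lattice_ball[OF L2] by (meson finite_SigmaI finite_subset)
  qed

  \<comment> \<open>Equilibria restricted to a cycle of best responses\<close>
  have nash: "finite Sx \<and> finite Sy \<and> (\<forall>p q. mixed_nash f g Sx Sy p q \<longrightarrow>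
      approx_mixed_nash f g \<Lambda>1 \<Lambda>2 (lx * (\<pi>1 + Bx)\<^sup>2) (ly * (\<pi>2 + By)\<^sup>2) p q)"
    if z0: "x0 \<in> \<Lambda>1" "y0 \<in> \<Lambda>2" and out: "br_outputs f g \<Lambda>1 \<Lambda>2 x0 y0 Sx Sy" for x0 y0 Sx Sy
  proof -
    obtain P where P: "finite P" "P \<noteq> {}" "P \<subseteq> \<Lambda>1 \<times> \<Lambda>2" "Sx = fst ` P" "Sy = snd ` P"
      "\<And>z'. z' \<in> P \<Longrightarrow> \<exists>z\<in>P. br_pair f g \<Lambda>1 \<Lambda>2 z z'"
      using br_outputs_closed[OF out z0] by metis
    have S: "finite Sx" "finite Sy" "Sx \<noteq> {}" "Sy \<noteq> {}" "Sx \<subseteq> \<Lambda>1" "Sy \<subseteq> \<Lambda>2"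
      using P(1-5) by auto
    have Sx_br: "\<exists>y\<in>Sy. is_arg_min (quad_obj Q1 (C1 *v y + d1)) (\<lambda>x. x \<in> \<Lambda>1) x" if "x \<in> Sx" for x
      using that P(4-6) unfolding br by fastforce
    have Sy_br: "\<exists>x\<in>Sx. is_arg_min (quad_obj Q2 (C2 *v x + d2)) (\<lambda>y. y \<in> \<Lambda>2) y" if "y \<in> Sy" for y
      using that P(4-6) unfolding br by fastforce
    define Dx where "Dx = diameter Sx"
    define Dy where "Dy = diameter Sy"
    have D: "\<And>x x'. x \<in> Sx \<Longrightarrow> x' \<in> Sx \<Longrightarrow> norm (x - x') \<le> Dx"
      "\<And>y y'. y \<in> Sy \<Longrightarrow> y' \<in> Sy \<Longrightarrow> norm (y - y') \<le> Dy"
      using S diameter_bounded_bound finite_imp_bounded unfolding Dx_def Dy_def dist_norm[symmetric]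
      by blast+
    have Dx: "Dx \<le> 2 * \<pi>1 + \<sigma>x * Dy"
      unfolding Dx_def
    proof (rule diameter_le)
      fix x x' assume "x \<in> Sx" "x' \<in> Sx"
      then obtain y y' where y: "y \<in> Sy" "is_arg_min (quad_obj Q1 (C1 *v y + d1)) (\<lambda>x. x \<in> \<Lambda>1) x"
        "y' \<in> Sy" "is_arg_min (quad_obj Q1 (C1 *v y' + d1)) (\<lambda>x. x \<in> \<Lambda>1) x'"
        using Sx_br by metis
      have "norm (x - x') \<le> 2 * \<pi>1 + \<sigma>x * norm (y - y')"
        unfolding \<pi>1_def \<sigma>x_def by (rule best_response_dist[OF Q1 L1 y(2,4)])
      also have "\<dots> \<le> 2 * \<pi>1 + \<sigma>x * Dy" using \<sigma> D(2) y by (intro add_left_mono mult_left_mono) auto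
      finally show "norm (x - x') \<le> 2 * \<pi>1 + \<sigma>x * Dy" .
    qed (use S in auto)
    have Dy: "Dy \<le> 2 * \<pi>2 + \<sigma>y * Dx"
      unfolding Dy_def
    proof (rule diameter_le)
      fix y y' assume "y \<in> Sy" "y' \<in> Sy"
      then obtain x x' where x: "x \<in> Sx" "is_arg_min (quad_obj Q2 (C2 *v x + d2)) (\<lambda>y. y \<in> \<Lambda>2) y"
        "x' \<in> Sx" "is_arg_min (quad_obj Q2 (C2 *v x' + d2)) (\<lambda>y. y \<in> \<Lambda>2) y'"
        using Sy_br by metis
      have "norm (y - y') \<le> 2 * \<pi>2 + \<sigma>y * norm (x - x')"
        unfolding \<pi>2_def \<sigma>y_def by (rule best_response_dist[OF Q2 L2 x(2,4)])
      also have "\<dots> \<le> 2 * \<pi>2 + \<sigma>y * Dx" using \<sigma> D(1) x by (intro add_left_mono mult_left_mono) auto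
      finally show "norm (y - y') \<le> 2 * \<pi>2 + \<sigma>y * Dx" .
    qed (use S in auto)
    \<comment> \<open>Inserting one diameter bound into the other gives \<open>(1 - \<sigma>x *
      \<sigma>y) * (\<sigma>x * Dy) \<le> 2 * \<pi>2 * \<sigma>x + 2 * \<pi>1 * \<sigma>x *
      \<sigma>y\<close>. Relaxing the last term to \<open>2 * \<pi>1\<close> produces the numerator
      of \<open>Bx\<close>.\<close>
    have "\<sigma>x * Dy \<le> \<sigma>x * (2 * \<pi>2 + \<sigma>y * (2 * \<pi>1 + \<sigma>x * Dy))"
      using Dx Dy \<sigma> by (smt (verit) mult_left_mono)
    moreover have "\<sigma>x * \<sigma>y * (2 * \<pi>1) \<le> 2 * \<pi>1" using \<sigma> \<sigma>\<sigma> \<pi> by (intro mult_left_le_one_le) auto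
    ultimately have Bx: "\<sigma>x * Dy \<le> Bx"
      using \<sigma>\<sigma> by (simp add: Bx_def pos_le_divide_eq algebra_simps)
    have "\<sigma>y * Dx \<le> \<sigma>y * (2 * \<pi>1 + \<sigma>x * (2 * \<pi>2 + \<sigma>y * Dx))"
      using Dx Dy \<sigma> by (smt (verit) mult_left_mono)
    moreover have "\<sigma>x * \<sigma>y * (2 * \<pi>2) \<le> 2 * \<pi>2" using \<sigma> \<sigma>\<sigma> \<pi> by (intro mult_left_le_one_le) auto
    ultimately have By: "\<sigma>y * Dx \<le> By"
      using \<sigma>\<sigma> by (simp add: By_def pos_le_divide_eq algebra_simps)
    \<comment> \<open>Nonnegative diameters keep the squared quantities nonnegative, so squaring
      preserves the bounds by \<open>Bx\<close> and \<open>By\<close>.\<close>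
    have D0: "0 \<le> Dx" "0 \<le> Dy"
      using S by (auto simp: Dx_def Dy_def intro!: diameter_ge_0 finite_imp_bounded)

    have "approx_mixed_nash f g \<Lambda>1 \<Lambda>2 (lx * (\<pi>1 + Bx)\<^sup>2) (ly * (\<pi>2 + By)\<^sup>2) p q"
      if "mixed_nash f g Sx Sy p q" for p q
    proof -
      have supp: "finite (set_pmf p)" "finite (set_pmf q)" "set_pmf p \<subseteq> Sx" "set_pmf q \<subseteq> Sy"
        and eq: "\<And>x. x \<in> Sx \<Longrightarrow> measure_pmf.expectation (pair_pmf p q) (\<lambda>(x, y). f x y)
            \<le> measure_pmf.expectation q (\<lambda>y. f x y)"
          "\<And>y. y \<in> Sy \<Longrightarrow> measure_pmf.expectation (pair_pmf p q) (\<lambda>(x, y). g x y)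
            \<le> measure_pmf.expectation p (\<lambda>x. g x y)"
        using that by (auto simp: mixed_nash_def approx_mixed_nash_def mixed_strategy_def)
      \<comment> \<open>Any \<open>s\<close> in \<open>Sx\<close> will do: the equilibrium costs no
        more than deviating to \<open>s\<close>, and \<open>s\<close> responds to some
        \<open>y\<close> within \<open>Dy\<close> of the whole support of \<open>q\<close>.\<close>
      obtain s y where s: "s \<in> Sx" "y \<in> Sy" "is_arg_min (quad_obj Q1 (C1 *v y + d1)) (\<lambda>x. x \<in> \<Lambda>1) s"
        using S Sx_br by blast
      obtain t x where t: "t \<in> Sy" "x \<in> Sx" "is_arg_min (quad_obj Q2 (C2 *v x + d2)) (\<lambda>y. y \<in> \<Lambda>2) t"
        using S Sy_br by blast
      have dev_x: "measure_pmf.expectation (pair_pmf p q) (\<lambda>(x, y). f x y)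
          \<le> measure_pmf.expectation q (\<lambda>y. f x' y) + lx * (\<pi>1 + Bx)\<^sup>2" for x'
      proof -
        have "measure_pmf.expectation (pair_pmf p q) (\<lambda>(x, y). f x y) \<le> measure_pmf.expectation q (\<lambda>y. f s y)"
          by (rule eq(1)[OF s(1)])
        also have "\<dots> \<le> measure_pmf.expectation q (\<lambda>y. f x' y) + lx * (\<pi>1 + \<sigma>x * Dy)\<^sup>2"
          unfolding f_def cost_x_def lx_def \<pi>1_def \<sigma>x_def
          using supp D(2) s by (intro best_response_mixed Q1 L1) auto
        also have "lx * (\<pi>1 + \<sigma>x * Dy)\<^sup>2 \<le> lx * (\<pi>1 + Bx)\<^sup>2"
          unfolding lx_def using Bx \<pi> \<sigma> D0
          by (intro mult_left_mono power_mono largest_eigenvalue_nonneg Q1) auto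
        finally show ?thesis by simp
      qed
      have dev_y: "measure_pmf.expectation (pair_pmf p q) (\<lambda>(x, y). g x y)
          \<le> measure_pmf.expectation p (\<lambda>x. g x y') + ly * (\<pi>2 + By)\<^sup>2" for y'
      proof -
        have "measure_pmf.expectation (pair_pmf p q) (\<lambda>(x, y). g x y) \<le> measure_pmf.expectation p (\<lambda>x. g x t)"
          by (rule eq(2)[OF t(1)])
        also have "\<dots> \<le> measure_pmf.expectation p (\<lambda>x. g x y') + ly * (\<pi>2 + \<sigma>y * Dx)\<^sup>2"
          unfolding g_def cost_y_def ly_def \<pi>2_def \<sigma>y_def
          using supp D(1) t by (intro best_response_mixed Q2 L2) auto
        also have "ly * (\<pi>2 + \<sigma>y * Dx)\<^sup>2 \<le> ly * (\<pi>2 + By)\<^sup>2"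
          unfolding ly_def using By \<pi> \<sigma> D0
          by (intro mult_left_mono power_mono largest_eigenvalue_nonneg Q2) auto
        finally show ?thesis by simp
      qed
      show ?thesis
        using supp S dev_x dev_y by (auto simp: approx_mixed_nash_def mixed_strategy_def)
    qed
    then show ?thesis using S by blast
  qed
  show ?thesis
    unfolding Let_def
    using terminates nash
    unfolding f_def g_def lx_def ly_def \<sigma>x_def \<sigma>y_def \<pi>1_def \<pi>2_def Bx_def By_def by blast
qed

end
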